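(* For distinct $z_1,\dots,z_4\in\mathbb{C}$, $q_1,\dots,q_4\in\mathbb{C}$ and $\lambda\in\mathbb{C}$, consider the symmetric general Heun equation $$\mathcal{F}''+\frac12\left(\sum_{j=1}^4\frac1{z-z_j}\right)\mathcal{F}'+\frac1{P(z)}\left(\lambda+\sum_{j=1}^4\frac{q_j}{z-z_j}\right)\mathcal{F}=0,\qquad P(z)=\prod_{j=1}^4(z-z_j),$$ and put $\sigma_4=z_1z_2z_3z_4$. This equation is invariant under the extension $\widehat{\mathfrak{G}}_{Mobius}$ of the Möbius group that acts on the ten variables $(z;z_1,\dots,z_4;q_1,\dots,q_4;\lambda)$ and is generated by the following basic transformations: (i) complex translations, $\zeta\in\mathbb{C}$: $z\to z+\zeta$; $z_j\to z_j+\zeta$; $q_j\to q_j$ ($j=1,\dots,4$); $\lambda\to\lambda$; (ii) complex dilatations, $t\in\mathbb{C}$, $t\neq0$: $z\to tz$; $z_j\to tz_j$; $q_j\to t^3q_j$ ($j=1,\dots,4$); $\lambda\to t^2\lambda$; (iii) inversion (when all $z_j\neq0$): $z\to1/z$; $z_j\to1/z_j$; $q_j\to-q_j/(z_j^2\sigma_4)$ ($j=1,\dots,4$); $\lambda\to\left(\lambda-\sum_{j=1}^4q_j/z_j\right)/\sigma_4$. That is, if $g$ is any of these transformations, or any composition of them (wherever it is defined), sending $(z;z_j;q_j;\lambda)$ to $(\tilde z;\tilde z_j;\tilde q_j;\tilde\lambda)$, then a function $\mathcal{F}$ of $z$ satisfies the equation with parameters $(z_j;q_j;\lambda)$ if and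 only if the function $\tilde{\mathcal{F}}$ defined by $\tilde{\mathcal{F}}(\tilde z)=\mathcal{F}(z)$ satisfies the equation in the independent variable $\tilde z$ with parameters $(\tilde z_j;\tilde q_j;\tilde\lambda)$.
   Context: Solutions are analytic functions on an open set $U\subset\mathbb{C}\setminus\{z_1,\dots,z_4\}$, and $\tilde{\mathcal{F}}$ is then considered on the image of $U$ under $z\mapsto\tilde z$. A transformation is "defined" when no inversion is applied at a step where the current $z$ or some current $z_j$ equals $0$. The action on the variable $z$ alone of the compositions of (i)–(iii) is by the usual Möbius transformations, which is why the group is called an extension of the Möbius group. *)

theory Defs
  imports "HOL-Analysis.Analysis"
begin

definition heun_P :: "complex^4 \<Rightarrow> complex \<Rightarrow> complex" where
  "heun_P a z = (\<Prod>j\<in>UNIV. z - a $ j)"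

text \<open>A solution carries its domain: an open set avoiding the singular points
  \<open>a $ j\<close>, so that no division by zero occurs in the equation.\<close>

definition heun_solution ::
  "complex^4 \<Rightarrow> complex^4 \<Rightarrow> complex \<Rightarrow> complex set \<Rightarrow> (complex \<Rightarrow> complex) \<Rightarrow> bool" where
  "heun_solution a q l U F \<longleftrightarrow>
     open U \<and> U \<inter> range (($) a) = {} \<and> F analytic_on U \<and>
     (\<forall>z\<in>U. deriv (deriv F) z
        + 1/2 * (\<Sum>j\<in>UNIV. 1 / (z - a $ j)) * deriv F z
        + 1 / heun_P a z * (l + (\<Sum>j\<in>UNIV. q $ j / (z - a $ j))) * F z = 0)"

text \<open>The ten variables \<open>(z; a; q; l)\<close>: the independent variable, the four singular
  points, the four coefficients \<open>q $ j\<close>, and \<open>\<lambda>\<close> (written \<open>l\<close>).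
  Transformations are partial maps, because of the inversion.\<close>

type_synonym heun_vars = "complex \<times> (complex^4) \<times> (complex^4) \<times> complex"

definition heun_translation :: "complex \<Rightarrow> heun_vars \<rightharpoonup> heun_vars" where
  "heun_translation \<zeta> = (\<lambda>(z, a, q, l). Some (z + \<zeta>, (\<chi> j. a $ j + \<zeta>), q, l))"

definition heun_dilatation :: "complex \<Rightarrow> heun_vars \<rightharpoonup> heun_vars" where
  "heun_dilatation t =
     (\<lambda>(z, a, q, l). Some (t * z, (\<chi> j. t * a $ j), (\<chi> j. t^3 * q $ j), t^2 * l))"

definition heun_inversion :: "heun_vars \<rightharpoonup> heun_vars" where
  "heun_inversion = (\<lambda>(z, a, q, l).
     if z = 0 \<or> (\<exists>j. a $ j = 0) then None
     else let \<sigma>4 = (\<Prod>j\<in>UNIV. a $ j) in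
       Some (1 / z, (\<chi> j. 1 / a $ j), (\<chi> j. - q $ j / ((a $ j)^2 * \<sigma>4)),
             (l - (\<Sum>j\<in>UNIV. q $ j / a $ j)) / \<sigma>4))"

text \<open>Closure under inverses needs no rule of its own: translations and dilatations
  are inverted by translations and dilatations, and the inversion is an involution on
  its domain. The identity is the translation by \<open>0\<close>.\<close>

inductive_set heun_moebius :: "(heun_vars \<rightharpoonup> heun_vars) set" where
  translation: "heun_translation \<zeta> \<in> heun_moebius"
| dilatation: "t \<noteq> 0 \<Longrightarrow> heun_dilatation t \<in> heun_moebius"
| inversion: "heun_inversion \<in> heun_moebius"
| composition: "g \<in> heun_moebius \<Longrightarrow> h \<in> heun_moebius \<Longrightarrow> h \<circ>\<^sub>m g \<in> heun_moebius"

end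

theory Submission
  imports Defs "HOL-Complex_Analysis.Conformal_Mappings"
begin

text \<open>Under a substitution \<open>z = \<psi> w\<close> an equation \<open>F'' + p F' + r F = 0\<close> turns into the equation
  with coefficients \<open>p', r'\<close> precisely when \<open>p' \<psi>' + \<psi>'' = \<psi>'\<^sup>2 (p \<circ> \<psi>)\<close> and
  \<open>r' = \<psi>'\<^sup>2 (r \<circ> \<psi>)\<close>. For each generator this is a rational identity; for the inversion, with
  \<open>w = 1/z\<close>, it rests on \<open>1 / (w - 1/z\<^sub>j) = z - z\<^sup>2 / (z - z\<^sub>j)\<close>, where the four summands \<open>z\<close>
  cancel the term \<open>\<psi>''\<close>. The converse implication is the same statement for the inverse generator,
  and compositions follow by transporting \<open>F\<close> through the intermediate variable.\<close>

section \<open>Change of variable in a second-order linear equation\<close>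

definition heun_p :: "complex^4 \<Rightarrow> complex \<Rightarrow> complex" where
  "heun_p a z = 1/2 * (\<Sum>j\<in>UNIV. 1 / (z - a $ j))"

definition heun_r :: "complex^4 \<Rightarrow> complex^4 \<Rightarrow> complex \<Rightarrow> complex \<Rightarrow> complex" where
  "heun_r a q l z = 1 / heun_P a z * (l + (\<Sum>j\<in>UNIV. q $ j / (z - a $ j)))"

lemma heun_solution_iff:
  "heun_solution a q l U F \<longleftrightarrow>
     open U \<and> U \<inter> range (($) a) = {} \<and> F analytic_on U \<and>
     (\<forall>z\<in>U. deriv (deriv F) z + heun_p a z * deriv F z + heun_r a q l z * F z = 0)"
  by (simp add: heun_solution_def heun_p_def heun_r_def)

text \<open>By the chain and product rules, \<open>p\<close> and \<open>r\<close> make the new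
  left-hand side at \<open>w\<close> equal to \<open>(\<psi>' w)^2\<close> times the old one at
  \<open>\<psi> w\<close>, which vanishes. Here \<open>\<psi>\<close> leads from the new variable
  back to the old one.\<close>

lemma heun_solution_substitution:
  assumes sol: "heun_solution a q l U F"
    and V: "open V" "V \<inter> range (($) a') = {}" "\<psi> ` V \<subseteq> U"
    and F': "\<And>w. w \<in> V \<Longrightarrow> F' w = F (\<psi> w)"
    and d1: "\<And>w. w \<in> V \<Longrightarrow> (\<psi> has_field_derivative \<psi>' w) (at w)"
    and d2: "\<And>w. w \<in> V \<Longrightarrow> (\<psi>' has_field_derivative \<psi>'' w) (at w)"
    and p: "\<And>w. w \<in> V \<Longrightarrow> heun_p a' w * \<psi>' w + \<psi>'' w = (\<psi>' w)^2 * heun_p a (\<psi> w)"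
    and r: "\<And>w. w \<in> V \<Longrightarrow> heun_r a' q' l' w = (\<psi>' w)^2 * heun_r a q l (\<psi> w)"
  shows "heun_solution a' q' l' V F'"
proof -
  have U: "open U" and F: "F holomorphic_on U"
    and eq: "\<And>z. z \<in> U \<Longrightarrow> deriv (deriv F) z + heun_p a z * deriv F z + heun_r a q l z * F z = 0"
    using sol by (auto simp: heun_solution_iff analytic_on_open)
  have D1: "(F' has_field_derivative deriv F (\<psi> w) * \<psi>' w) (at w)" if w: "w \<in> V" for w
  proof -
    have "(F has_field_derivative deriv F (\<psi> w)) (at (\<psi> w))"
      using F U V(3) w by (auto intro: holomorphic_derivI)
    then have "((\<lambda>w. F (\<psi> w)) has_field_derivative deriv F (\<psi> w) * \<psi>' w) (at w)"
      using d1[OF w] by (rule DERIV_chain2)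
    \<comment> \<open>The composite and \<open>F'\<close> agree on the open set \<open>V\<close>,
      hence have the same derivative there.\<close>
    then show ?thesis
      using has_field_derivative_transform_within_open[OF _ V(1) w] F' by fastforce
  qed
  have D2: "(deriv F' has_field_derivative
      deriv (deriv F) (\<psi> w) * \<psi>' w * \<psi>' w + \<psi>'' w * deriv F (\<psi> w)) (at w)" if w: "w \<in> V" for w
  proof -
    have "(deriv F has_field_derivative deriv (deriv F) (\<psi> w)) (at (\<psi> w))"
      using holomorphic_deriv[OF F U] U V(3) w by (auto intro: holomorphic_derivI)
    then have "((\<lambda>w. deriv F (\<psi> w)) has_field_derivative deriv (deriv F) (\<psi> w) * \<psi>' w) (at w)"
      using d1[OF w] by (rule DERIV_chain2)
    then have "((\<lambda>w. deriv F (\<psi> w) * \<psi>' w) has_field_derivative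
        deriv (deriv F) (\<psi> w) * \<psi>' w * \<psi>' w + \<psi>'' w * deriv F (\<psi> w)) (at w)"
      using d2[OF w] by (rule DERIV_mult)
    then show ?thesis
      using has_field_derivative_transform_within_open[OF _ V(1) w] DERIV_imp_deriv[OF D1] by fastforce
  qed
  have "F' analytic_on V"
    using D1 V(1) by (auto simp: analytic_on_open holomorphic_on_open)
  moreover have "deriv (deriv F') w + heun_p a' w * deriv F' w + heun_r a' q' l' w * F' w = 0"
    if w: "w \<in> V" for w
  proof -
    have "deriv (deriv F') w + heun_p a' w * deriv F' w + heun_r a' q' l' w * F' w
      = deriv (deriv F) (\<psi> w) * (\<psi>' w)^2 + (heun_p a' w * \<psi>' w + \<psi>'' w) * deriv F (\<psi> w)
        + heun_r a' q' l' w * F (\<psi> w)"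
      by (simp add: DERIV_imp_deriv[OF D1[OF w]] DERIV_imp_deriv[OF D2[OF w]] F'[OF w]
          power2_eq_square algebra_simps)
    also have "\<dots> = (\<psi>' w)^2 * (deriv (deriv F) (\<psi> w) + heun_p a (\<psi> w) * deriv F (\<psi> w)
        + heun_r a q l (\<psi> w) * F (\<psi> w))"
      unfolding p[OF w] r[OF w] by (simp add: algebra_simps)
    also have "\<dots> = 0"
      using eq V(3) w by auto
    finally show ?thesis .
  qed
  ultimately show ?thesis
    using V by (simp add: heun_solution_iff)
qed

section \<open>Two-sided covariance and its composition\<close>

definition heun_covariant_on ::
  "complex set \<Rightarrow> (complex \<Rightarrow> complex) \<Rightarrow> complex^4 \<Rightarrow> complex^4 \<Rightarrow> complex
     \<Rightarrow> complex^4 \<Rightarrow> complex^4 \<Rightarrow> complex \<Rightarrow> bool" where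
  "heun_covariant_on U \<phi> a q l a' q' l' \<longleftrightarrow>
     inj_on \<phi> U \<and> open (\<phi> ` U) \<and> inj (($) a') \<and> \<phi> ` U \<inter> range (($) a') = {} \<and>
     (\<forall>F F'. (\<forall>z\<in>U. F' (\<phi> z) = F z) \<longrightarrow>
       (heun_solution a q l U F \<longleftrightarrow> heun_solution a' q' l' (\<phi> ` U) F'))"

lemma heun_covariant_on_comp:
  assumes "heun_covariant_on U \<phi> a q l a' q' l'"
    and "heun_covariant_on (\<phi> ` U) \<theta> a' q' l' a'' q'' l''"
  shows "heun_covariant_on U (\<theta> \<circ> \<phi>) a q l a'' q'' l''"
proof -
  have "heun_solution a q l U F \<longleftrightarrow> heun_solution a'' q'' l'' ((\<theta> \<circ> \<phi>) ` U) F'"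
    if "\<forall>z\<in>U. F' ((\<theta> \<circ> \<phi>) z) = F z" for F F'
  proof -
    \<comment> \<open>\<open>F' \<circ> \<theta>\<close> is the same function written in the
      intermediate variable.\<close>
    have "heun_solution a q l U F \<longleftrightarrow> heun_solution a' q' l' (\<phi> ` U) (F' \<circ> \<theta>)"
      using assms(1) that by (simp add: heun_covariant_on_def o_def)
    also have "\<dots> \<longleftrightarrow> heun_solution a'' q'' l'' (\<theta> ` \<phi> ` U) F'"
      using assms(2) by (simp add: heun_covariant_on_def o_def)
    finally show ?thesis
      by (simp add: image_comp)
  qed
  then show ?thesis
    using assms by (auto simp: heun_covariant_on_def image_comp comp_inj_on)
qed

section \<open>Translations\<close>

lemma heun_solution_translation:
  assumes sol: "heun_solution a q l U F" and F': "\<And>z. z \<in> U \<Longrightarrow> F' (z + \<zeta>) = F z"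
  shows "heun_solution (\<chi> j. a $ j + \<zeta>) q l ((\<lambda>z. z + \<zeta>) ` U) F'"
  using sol
proof (rule heun_solution_substitution[where \<psi> = "\<lambda>w. w - \<zeta>" and \<psi>' = "\<lambda>_. 1" and \<psi>'' = "\<lambda>_. 0"])
  have "open ((+) \<zeta> ` U)"
    using sol by (intro open_translation) (auto simp: heun_solution_def)
  then show "open ((\<lambda>z. z + \<zeta>) ` U)"
    by (simp add: add.commute)
  show "(\<lambda>z. z + \<zeta>) ` U \<inter> range (($) (\<chi> j. a $ j + \<zeta>)) = {}"
    using sol by (auto simp: heun_solution_def)
\<comment> \<open>All differences \<open>z - a $ j\<close> are unchanged, so both coefficients are
  merely shifted.\<close>
qed (auto simp: F' heun_p_def heun_r_def heun_P_def algebra_simps intro!: derivative_eq_intros)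

lemma heun_covariant_on_translation:
  assumes "open U" "U \<inter> range (($) a) = {}" "inj (($) a)"
  shows "heun_covariant_on U (\<lambda>z. z + \<zeta>) a q l (\<chi> j. a $ j + \<zeta>) q l"
proof -
  have "open ((\<lambda>z. z + \<zeta>) ` U)"
    using open_translation[OF assms(1), of \<zeta>] by (simp add: add.commute)
  moreover have "heun_solution a q l U F"
    if "\<forall>z\<in>U. F' (z + \<zeta>) = F z" "heun_solution (\<chi> j. a $ j + \<zeta>) q l ((\<lambda>z. z + \<zeta>) ` U) F'" for F F'
  proof -
    have "F (w + - \<zeta>) = F' w" if "w \<in> (\<lambda>z. z + \<zeta>) ` U" for w
      using that \<open>\<forall>z\<in>U. F' (z + \<zeta>) = F z\<close> by auto
    \<comment> \<open>The converse is the translation by \<open>- \<zeta>\<close>, with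
      \<open>F\<close> and \<open>F'\<close> exchanged.\<close>
    from heun_solution_translation[OF that(2) this] show ?thesis
      by (simp add: image_comp o_def)
  qed
  ultimately show ?thesis
    using assms heun_solution_translation
    by (auto simp: heun_covariant_on_def inj_def)
qed

section \<open>Dilatations\<close>

text \<open>Each difference \<open>z - a $ j\<close> gains a factor \<open>t\<close>, hence
  \<open>heun_P\<close> gains \<open>t^4\<close>. The weights 3 and 2 give both terms of the bracket
  in \<open>heun_r\<close> the factor \<open>t^2\<close>, so \<open>heun_r\<close> scales by
  \<open>1 / t^2\<close>, the square of \<open>\<psi>'\<close>.\<close>

lemma heun_solution_dilatation:
  assumes sol: "heun_solution a q l U F" and t: "t \<noteq> 0" and F': "\<And>z. z \<in> U \<Longrightarrow> F' (t * z) = F z"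
  shows "heun_solution (\<chi> j. t * a $ j) (\<chi> j. t^3 * q $ j) (t^2 * l) ((*) t ` U) F'"
  using sol
proof (rule heun_solution_substitution[where \<psi> = "\<lambda>w. w / t" and \<psi>' = "\<lambda>_. 1 / t" and \<psi>'' = "\<lambda>_. 0"])
  show "open ((*) t ` U)"
    using sol t by (intro open_mapping_thm3) (auto simp: heun_solution_def inj_on_def intro!: holomorphic_intros)
  show "(*) t ` U \<inter> range (($) (\<chi> j. t * a $ j)) = {}"
    using sol t by (auto simp: heun_solution_def)
  fix w assume "w \<in> (*) t ` U"
  then obtain z where w: "w = t * z" and z: "z \<in> U" by auto
  have P: "heun_P (\<chi> j. t * a $ j) w = t^4 * heun_P a z"
    by (simp add: heun_P_def w prod.distrib flip: right_diff_distrib)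
  have p: "heun_p (\<chi> j. t * a $ j) w = heun_p a z / t"
    by (simp add: heun_p_def w sum_divide_distrib flip: right_diff_distrib)
       (simp add: field_simps)
  show "heun_p (\<chi> j. t * a $ j) w * (1 / t) + 0 = (1 / t)^2 * heun_p a (w / t)"
    unfolding p using t by (simp add: w power2_eq_square)
  have "(\<Sum>j\<in>UNIV. (\<chi> j. t^3 * q $ j) $ j / (w - (\<chi> j. t * a $ j) $ j))
      = t^2 * (\<Sum>j\<in>UNIV. q $ j / (z - a $ j))"
    using t by (simp add: w sum_distrib_left power2_eq_square power3_eq_cube mult.assoc flip: right_diff_distrib)
  then have "heun_r (\<chi> j. t * a $ j) (\<chi> j. t^3 * q $ j) (t^2 * l) w
      = 1 / (t^4 * heun_P a z) * (t^2 * (l + (\<Sum>j\<in>UNIV. q $ j / (z - a $ j))))"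
    unfolding heun_r_def P by (simp only: distrib_left)
  also have "\<dots> = (1 / t)^2 * heun_r a q l z"
    using t by (simp add: heun_r_def power2_eq_square power4_eq_xxxx)
  finally show "heun_r (\<chi> j. t * a $ j) (\<chi> j. t^3 * q $ j) (t^2 * l) w
      = (1 / t)^2 * heun_r a q l (w / t)"
    using t by (simp add: w)
qed (use t F' in \<open>auto intro!: derivative_eq_intros\<close>)

lemma heun_covariant_on_dilatation:
  assumes "open U" "U \<inter> range (($) a) = {}" "inj (($) a)" and t: "t \<noteq> 0"
  shows "heun_covariant_on U ((*) t) a q l (\<chi> j. t * a $ j) (\<chi> j. t^3 * q $ j) (t^2 * l)"
proof -
  have "open ((*) t ` U)"
    using assms by (intro open_mapping_thm3) (auto simp: inj_on_def intro!: holomorphic_intros)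
  moreover have "heun_solution a q l U F"
    if "\<forall>z\<in>U. F' (t * z) = F z"
      "heun_solution (\<chi> j. t * a $ j) (\<chi> j. t^3 * q $ j) (t^2 * l) ((*) t ` U) F'" for F F'
  proof -
    have "1 / t \<noteq> 0"
      using t by simp
    moreover have "F (1 / t * w) = F' w" if "w \<in> (*) t ` U" for w
      using that t \<open>\<forall>z\<in>U. F' (t * z) = F z\<close> by auto
    ultimately show ?thesis
      using heun_solution_dilatation[OF that(2), of "1 / t" F] t
      by (simp add: image_comp o_def power_divide)
  qed
  ultimately show ?thesis
    using assms heun_solution_dilatation
    by (auto simp: heun_covariant_on_def inj_def inj_on_def)
qed

section \<open>Inversion\<close>

text \<open>With \<open>inversion_l\<close>, this makes the parameter part of
  \<open>heun_inversion\<close> total, so that inverting twice can be written by nesting.\<close>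

definition inversion_q :: "complex^4 \<Rightarrow> complex^4 \<Rightarrow> complex^4" where
  "inversion_q a q = (\<chi> j. - q $ j / ((a $ j)^2 * (\<Prod>j\<in>UNIV. a $ j)))"

definition inversion_l :: "complex^4 \<Rightarrow> complex^4 \<Rightarrow> complex \<Rightarrow> complex" where
  "inversion_l a q l = (l - (\<Sum>j\<in>UNIV. q $ j / a $ j)) / (\<Prod>j\<in>UNIV. a $ j)"

lemma inversion_q_involution:
  assumes "\<And>j. a $ j \<noteq> 0"
  shows "inversion_q (\<chi> j. 1 / a $ j) (inversion_q a q) = q"
  using assms by (simp add: inversion_q_def vec_eq_iff prod_dividef power_divide)

text \<open>With \<open>S\<close> the sum of the \<open>q $ j / a $ j\<close>, the transformed sum
  is \<open>- S / \<sigma>\<close> and the transformed product is \<open>1 / \<sigma>\<close>, so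
  the second inversion gives
  \<open>((l - S) / \<sigma> + S / \<sigma>) * \<sigma> = l\<close>.\<close>

lemma inversion_l_involution:
  assumes "\<And>j. a $ j \<noteq> 0"
  shows "inversion_l (\<chi> j. 1 / a $ j) (inversion_q a q) (inversion_l a q l) = l"
proof -
  define \<sigma> where "\<sigma> = (\<Prod>j\<in>UNIV. a $ j)"
  have \<sigma>: "\<sigma> \<noteq> 0"
    using assms by (simp add: \<sigma>_def)
  have "(\<Sum>j\<in>UNIV. inversion_q a q $ j / (\<chi> j. 1 / a $ j) $ j) = - (\<Sum>j\<in>UNIV. q $ j / a $ j) / \<sigma>"
    unfolding inversion_q_def \<sigma>_def[symmetric] using assms
    by (simp add: sum_divide_distrib power2_eq_square mult_ac flip: sum_negf)
  then show ?thesis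
    using \<sigma> by (simp add: inversion_l_def prod_dividef flip: \<sigma>_def) (simp add: field_simps)
qed

lemma heun_solution_inversion:
  assumes sol: "heun_solution a q l U F" and a: "\<And>j. a $ j \<noteq> 0" and U0: "0 \<notin> U"
    and F': "\<And>z. z \<in> U \<Longrightarrow> F' (1 / z) = F z"
  shows "heun_solution (\<chi> j. 1 / a $ j) (inversion_q a q) (inversion_l a q l) ((\<lambda>z. 1 / z) ` U) F'"
  using sol
proof (rule heun_solution_substitution[where \<psi> = "\<lambda>w. 1 / w" and \<psi>' = "\<lambda>w. - 1 / w^2"
      and \<psi>'' = "\<lambda>w. 2 / w^3"])
  show "open ((\<lambda>z. 1 / z) ` U)"
    using sol U0
    by (intro open_mapping_thm3) (auto simp: heun_solution_def inj_on_def intro!: holomorphic_intros)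
  show "(\<lambda>z. 1 / z) ` U \<inter> range (($) (\<chi> j. 1 / a $ j)) = {}"
    using sol by (auto simp: heun_solution_def)
  fix w assume "w \<in> (\<lambda>z. 1 / z) ` U"
  then obtain z where w: "w = 1 / z" and z: "z \<in> U" by auto
  have z0: "z \<noteq> 0"
    using z U0 by auto
  then have w0: "w \<noteq> 0"
    by (simp add: w)
  have za: "z - a $ j \<noteq> 0" for j
    using sol z by (auto simp: heun_solution_def)
  show "((\<lambda>w. 1 / w) has_field_derivative - 1 / w^2) (at w)"
    using w0 by (auto intro!: derivative_eq_intros simp: power2_eq_square)
  show "((\<lambda>w. - 1 / w^2) has_field_derivative 2 / w^3) (at w)"
    using w0 by (auto intro!: derivative_eq_intros simp: field_simps eval_nat_numeral)
  have pole: "1 / (w - 1 / a $ j) = z - z^2 * (1 / (z - a $ j))" for j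
    using z0 a[of j] za[of j] by (simp add: w divide_simps power2_eq_square) (simp add: algebra_simps)
  \<comment> \<open>The term \<open>2 * z\<close> is half of the four summands
    \<open>z\<close>.\<close>
  have p: "heun_p (\<chi> j. 1 / a $ j) w = 2 * z - z^2 * heun_p a z"
    by (simp only: heun_p_def vec_lambda_beta pole sum_subtractf flip: sum_distrib_left)
       (simp add: algebra_simps)
  show "heun_p (\<chi> j. 1 / a $ j) w * (- 1 / w^2) + 2 / w^3 = (- 1 / w^2)^2 * heun_p a (1 / w)"
    using z0 unfolding p by (simp add: w algebra_simps eval_nat_numeral)
  define \<sigma> where "\<sigma> = (\<Prod>j\<in>UNIV. a $ j)"
  have \<sigma>: "\<sigma> \<noteq> 0"
    using a by (simp add: \<sigma>_def)
  \<comment> \<open>The sign is split off as a factor \<open>- 1\<close>, which disappears in the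
    product of four factors.\<close>
  have "w - 1 / a $ j = - 1 * (z - a $ j) / (z * a $ j)" for j
    using z0 a[of j] by (simp add: w field_simps)
  then have P: "heun_P (\<chi> j. 1 / a $ j) w = heun_P a z / (z^4 * \<sigma>)"
    unfolding heun_P_def \<sigma>_def vec_lambda_beta by (simp only: prod_dividef prod.distrib) simp
  \<comment> \<open>Summed over \<open>j\<close>, the surplus terms \<open>q $ j / a $ j\<close> are
    exactly what \<open>inversion_l\<close> subtracts from \<open>l\<close>.\<close>
  have "inversion_q a q $ j / (w - 1 / a $ j) = (q $ j / a $ j + q $ j / (z - a $ j)) / \<sigma>" for j
  proof -
    have "inversion_q a q $ j / (w - 1 / a $ j)
        = - q $ j / ((a $ j)^2 * \<sigma>) * (1 / (w - 1 / a $ j))"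
      by (simp add: inversion_q_def \<sigma>_def)
    also have "\<dots> = (q $ j / a $ j + q $ j / (z - a $ j)) / \<sigma>"
      unfolding pole using z0 \<sigma> a[of j] za[of j]
      by (simp add: divide_simps power2_eq_square) (simp add: algebra_simps)
    finally show ?thesis .
  qed
  then have "(\<Sum>j\<in>UNIV. inversion_q a q $ j / (w - (\<chi> j. 1 / a $ j) $ j))
      = ((\<Sum>j\<in>UNIV. q $ j / a $ j) + (\<Sum>j\<in>UNIV. q $ j / (z - a $ j))) / \<sigma>"
    by (simp only: vec_lambda_beta sum.distrib flip: sum_divide_distrib)
  then have "inversion_l a q l + (\<Sum>j\<in>UNIV. inversion_q a q $ j / (w - (\<chi> j. 1 / a $ j) $ j))
      = (l + (\<Sum>j\<in>UNIV. q $ j / (z - a $ j))) / \<sigma>"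
    by (simp add: inversion_l_def add_divide_distrib diff_divide_distrib flip: \<sigma>_def)
  then have "heun_r (\<chi> j. 1 / a $ j) (inversion_q a q) (inversion_l a q l) w = z^4 * heun_r a q l z"
    unfolding heun_r_def P using \<sigma> by simp
  then show "heun_r (\<chi> j. 1 / a $ j) (inversion_q a q) (inversion_l a q l) w
      = (- 1 / w^2)^2 * heun_r a q l (1 / w)"
    by (simp add: w power_divide flip: power_mult)
qed (use F' in auto)

lemma heun_covariant_on_inversion:
  assumes "open U" "U \<inter> range (($) a) = {}" "inj (($) a)"
    and a: "\<And>j. a $ j \<noteq> 0" and U0: "0 \<notin> U"
  shows "heun_covariant_on U (\<lambda>z. 1 / z) a q l
    (\<chi> j. 1 / a $ j) (inversion_q a q) (inversion_l a q l)"
proof -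
  have "open ((\<lambda>z. 1 / z) ` U)"
    using assms by (intro open_mapping_thm3) (auto simp: inj_on_def intro!: holomorphic_intros)
  moreover have "heun_solution a q l U F"
    if "\<forall>z\<in>U. F' (1 / z) = F z"
      "heun_solution (\<chi> j. 1 / a $ j) (inversion_q a q) (inversion_l a q l) ((\<lambda>z. 1 / z) ` U) F'"
    for F F'
  proof -
    have "F (1 / w) = F' w" if "w \<in> (\<lambda>z. 1 / z) ` U" for w
      using that \<open>\<forall>z\<in>U. F' (1 / z) = F z\<close> by auto
    moreover have "0 \<notin> (\<lambda>z. 1 / z) ` U"
      using U0 by auto
    \<comment> \<open>The converse is a second inversion, which restores \<open>a\<close>,
      \<open>q\<close> and \<open>l\<close> by the involution lemmas.\<close>
    ultimately show ?thesis
      using heun_solution_inversion[OF that(2), of F] a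
      by (simp add: image_comp o_def inversion_q_involution inversion_l_involution)
  qed
  ultimately show ?thesis
    using assms heun_solution_inversion
    by (auto simp: heun_covariant_on_def inj_def inj_on_def)
qed

section \<open>Arbitrary compositions\<close>

text \<open>The new parameters are chosen before \<open>z\<close>: no generator lets them depend on
  the independent variable. The induction generalizes over \<open>U\<close>, \<open>a\<close>,
  \<open>q\<close>, \<open>l\<close> because the outer map of a composition acts on the image
  data.\<close>

lemma heun_moebius_covariant_on:
  assumes "g \<in> heun_moebius" and "inj (($) a)" "open U" "U \<inter> range (($) a) = {}"
    and "\<And>z. z \<in> U \<Longrightarrow> (z, a, q, l) \<in> dom g"
  shows "\<exists>\<phi> a' q' l'. (\<forall>z\<in>U. g (z, a, q, l) = Some (\<phi> z, a', q', l')) \<and>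
    heun_covariant_on U \<phi> a q l a' q' l'"
  using assms
proof (induction arbitrary: U a q l)
  case (translation \<zeta>)
  then show ?case
    using heun_covariant_on_translation[of U a \<zeta> q l] by (fastforce simp: heun_translation_def)
next
  case (dilatation t)
  then show ?case
    using heun_covariant_on_dilatation[of U a t q l] by (fastforce simp: heun_dilatation_def)
next
  case inversion
  show ?case
  proof (cases "U = {}")
    \<comment> \<open>On an empty \<open>U\<close> the domain hypothesis is vacuous and some
      \<open>a $ j\<close> may be 0, so the identity translation supplies the witnesses.\<close>
    case True
    then show ?thesis
      using heun_covariant_on_translation[of U a 0 q l] inversion by blast
  next
    case False
    then have a: "\<And>j. a $ j \<noteq> 0" and U0: "0 \<notin> U"
      using inversion(4) by (fastforce simp: heun_inversion_def split: if_splits)+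
    have "heun_inversion (z, a, q, l)
        = Some (1 / z, (\<chi> j. 1 / a $ j), inversion_q a q, inversion_l a q l)" if "z \<in> U" for z
      using that a U0 by (auto simp: heun_inversion_def inversion_q_def inversion_l_def Let_def)
    then show ?thesis
      using heun_covariant_on_inversion[of U a q l] inversion a U0 by blast
  qed
next
  case (composition g h)
  have "(z, a, q, l) \<in> dom g" if "z \<in> U" for z
    using composition.prems(4)[OF that] by (auto simp: map_comp_def split: option.splits)
  then obtain \<phi> a' q' l' where g: "\<forall>z\<in>U. g (z, a, q, l) = Some (\<phi> z, a', q', l')"
    and \<phi>: "heun_covariant_on U \<phi> a q l a' q' l'"
    using composition.IH(1)[OF composition.prems(1-3), of q l] by blast
  from \<phi> have inj': "inj (($) a')" and op: "open (\<phi> ` U)" and disj: "\<phi> ` U \<inter> range (($) a') = {}"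
    by (simp_all add: heun_covariant_on_def)
  \<comment> \<open>Definedness of the composition on \<open>U\<close> passes to \<open>h\<close> on
    the image.\<close>
  have "(w, a', q', l') \<in> dom h" if "w \<in> \<phi> ` U" for w
    using composition.prems(4) g that by (fastforce simp: map_comp_def split: option.splits)
  then obtain \<theta> a'' q'' l'' where h: "\<forall>w\<in>\<phi> ` U. h (w, a', q', l') = Some (\<theta> w, a'', q'', l'')"
    and \<theta>: "heun_covariant_on (\<phi> ` U) \<theta> a' q' l' a'' q'' l''"
    using composition.IH(2)[OF inj' op disj, of q' l'] by blast
  have "\<forall>z\<in>U. (h \<circ>\<^sub>m g) (z, a, q, l) = Some ((\<theta> \<circ> \<phi>) z, a'', q'', l'')"
    using g h by (simp add: map_comp_def)
  then show ?case
    using heun_covariant_on_comp[OF \<phi> \<theta>] by blast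
qed

theorem proposition2:
  fixes a q :: "complex^4" and l :: complex and U :: "complex set"
    and g :: "heun_vars \<rightharpoonup> heun_vars"
  assumes "inj (($) a)"
    and "open U" and "U \<inter> range (($) a) = {}"
    and "g \<in> heun_moebius"
    and "\<And>z. z \<in> U \<Longrightarrow> (z, a, q, l) \<in> dom g"
  shows "\<exists>\<phi> a' q' l'.
    (\<forall>z\<in>U. g (z, a, q, l) = Some (\<phi> z, a', q', l')) \<and>
    inj (($) a') \<and> inj_on \<phi> U \<and>
    (\<forall>F F'. (\<forall>z\<in>U. F' (\<phi> z) = F z) \<longrightarrow>
       (heun_solution a q l U F \<longleftrightarrow> heun_solution a' q' l' (\<phi> ` U) F'))"
  using heun_moebius_covariant_on[OF assms(4,1-3,5)] unfolding heun_covariant_on_def by blast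

end
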